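(* Let $\mathcal{H}_{\mathfrak l}$ be a Hilbert space of finite dimension $n_{\mathfrak l}\ge 2$ and let $\mathcal{H}_{\mathfrak w}$ have dimension $n_{\mathfrak w}=2$. Let the interaction Hamiltonian $H_{\mathfrak{lw}}$ on $\mathcal{H}_{\mathfrak l}\otimes\mathcal{H}_{\mathfrak w}$ be given in operator-Schmidt form $H_{\mathfrak{lw}} = \sum_{i\ge1}s_i\,C_i\otimes D_i$ (as described in the context), and suppose $s_1 > s_i$ for all $i>1$. Let $$\Gamma_2(|w\rangle) = \sum_i s_i^2\,\mathrm{Var}_{|w\rangle}(D_i).$$ Then choosing $|w\rangle$ to be a (normalized) eigenvector of $D_1$ minimizes $\Gamma_2(|w\rangle)$ over the union $\bigcup_{i=1}^3\mathrm{eigenvectors}(D_i)$ of the sets of normalized eigenvectors of $D_1,D_2,D_3$, and locally minimizes $\Gamma_2(|w\rangle)$ over the set of pure states of $\mathcal{H}_{\mathfrak w}$.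
   Context: $H_{\mathfrak{lw}}$ is a pure interaction term: a Hermitian operator in the real span of $\sigma_i^{\mathfrak l}\otimes\sigma_j^{\mathfrak w}$, $i,j>0$, where $\{\sigma_i^{\mathfrak u}\}_{i\ge0}$ is a basis of Hermitian matrices on $\mathcal{H}_{\mathfrak u}$ orthonormal for $\langle A,B\rangle=\mathrm{tr}(AB)$ with $\sigma_0^{\mathfrak u} = \mathbb{1}/\sqrt{n_{\mathfrak u}}$. Its operator-Schmidt decomposition (OSD), obtained from a real singular value decomposition of the coefficient matrix, is $H_{\mathfrak{lw}} = \sum_{i=1}^{n_{\mathfrak u}^2}s_iC_i\otimes D_i$ with $n_{\mathfrak u}=\min\{n_{\mathfrak l},n_{\mathfrak w}\}$ (here $=2$), singular values $s_1\ge s_2\ge\dots\ge s_{n_{\mathfrak u}^2}=0$, Hermitian operators $C_i$ on $\mathcal{H}_{\mathfrak l}$ and $D_i$ on $\mathcal{H}_{\mathfrak w}$ satisfying $\mathrm{tr}(C_iC_j)=\mathrm{tr}(D_iD_j)=\delta_{ij}$, $\mathrm{tr}(C_i)=\mathrm{tr}(D_i)=0$ for $i<n_{\mathfrak u}^2$, and $C_{n_{\mathfrak u}^2}=\sigma_0^{\mathfrak l}$, $D_{n_{\mathfrak u}^2}=\sigma_0^{\mathfrak w}$. For a unit vector $|w\rangle$, $\mathrm{Var}_{|w\rangle}(D) = \langle w|D^2|w\rangle - \langle w|D|w\rangle^2$. *)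

theory Defs
  imports "HOL-Analysis.Analysis"
begin

text \<open>Operators on the Hilbert space \<open>\<complex>\<^sup>n\<close> are matrices of type \<open>complex ^ 'n ^ 'n\<close>, where
  \<open>n = CARD('n)\<close>; operators on the tensor product of two such spaces are matrices indexed by
  the product type.\<close>

definition hermitian :: "complex ^ 'n ^ 'n \<Rightarrow> bool" where
  "hermitian A \<longleftrightarrow> (\<forall>i j. A $ i $ j = cnj (A $ j $ i))"

definition kron :: "complex ^ 'a ^ 'a \<Rightarrow> complex ^ 'b ^ 'b \<Rightarrow> complex ^ ('a \<times> 'b) ^ ('a \<times> 'b)" where
  "kron A B = (\<chi> p q. A $ fst p $ fst q * B $ snd p $ snd q)"

definition sigma0 :: "complex ^ 'n ^ 'n" where
  "sigma0 = (1 / sqrt (real CARD('n))) *\<^sub>R mat 1"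

text \<open>In the next two definitions \<open>span\<close> is the span over the reals.\<close>

definition hermitian_onb :: "(nat \<Rightarrow> complex ^ 'n ^ 'n) \<Rightarrow> bool" where
  "hermitian_onb \<sigma> \<longleftrightarrow>
     (\<forall>i < CARD('n)\<^sup>2. hermitian (\<sigma> i)) \<and>
     (\<forall>i < CARD('n)\<^sup>2. \<forall>j < CARD('n)\<^sup>2. trace (\<sigma> i ** \<sigma> j) = (if i = j then 1 else 0)) \<and>
     span (\<sigma> ` {..<CARD('n)\<^sup>2}) = {A. hermitian A} \<and>
     \<sigma> 0 = sigma0"

definition pure_interaction ::
    "(nat \<Rightarrow> complex ^ 'l ^ 'l) \<Rightarrow> (nat \<Rightarrow> complex ^ 'w ^ 'w) \<Rightarrow>
     complex ^ ('l \<times> 'w) ^ ('l \<times> 'w) \<Rightarrow> bool" where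
  "pure_interaction \<sigma>l \<sigma>w H \<longleftrightarrow>
     hermitian H \<and>
     H \<in> span {kron (\<sigma>l i) (\<sigma>w j) | i j. i \<in> {0<..<CARD('l)\<^sup>2} \<and> j \<in> {0<..<CARD('w)\<^sup>2}}"

text \<open>The operator-Schmidt decomposition of a pure interaction term, indexed from 1 to
  \<open>N = (min n\<^sub>l n\<^sub>w)\<^sup>2\<close>. Expanding the \<open>C k\<close> and \<open>D k\<close> in orthonormal Hermitian bases gives
  real orthonormal coefficient vectors, so these conditions describe a real singular value
  decomposition of the coefficient matrix of \<open>H\<close> in which the last pair of singular vectors
  belongs to the zero row and column of index 0.\<close>

definition operator_schmidt ::
    "complex ^ ('l \<times> 'w) ^ ('l \<times> 'w) \<Rightarrow> (nat \<Rightarrow> real) \<Rightarrow>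
     (nat \<Rightarrow> complex ^ 'l ^ 'l) \<Rightarrow> (nat \<Rightarrow> complex ^ 'w ^ 'w) \<Rightarrow> bool" where
  "operator_schmidt H s C D \<longleftrightarrow>
     (let N = (min CARD('l) CARD('w))\<^sup>2 in
        H = (\<Sum>i=1..N. s i *\<^sub>R kron (C i) (D i)) \<and>
        antimono_on {1..N} s \<and> s N = 0 \<and>
        (\<forall>i\<in>{1..N}. hermitian (C i) \<and> hermitian (D i)) \<and>
        (\<forall>i\<in>{1..N}. \<forall>j\<in>{1..N}. trace (C i ** C j) = (if i = j then 1 else 0)) \<and>
        (\<forall>i\<in>{1..N}. \<forall>j\<in>{1..N}. trace (D i ** D j) = (if i = j then 1 else 0)) \<and>
        (\<forall>i\<in>{1..<N}. trace (C i) = 0 \<and> trace (D i) = 0) \<and>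
        C N = sigma0 \<and> D N = sigma0)"

definition expect :: "complex ^ 'n \<Rightarrow> complex ^ 'n ^ 'n \<Rightarrow> complex" where
  "expect w A = (\<Sum>i\<in>UNIV. cnj (w $ i) * (A *v w) $ i)"

text \<open>For Hermitian \<open>A\<close> both expectation values are real, so taking the real part only changes
  the type.\<close>

definition Var :: "complex ^ 'n \<Rightarrow> complex ^ 'n ^ 'n \<Rightarrow> real" where
  "Var w A = Re (expect w (A ** A) - (expect w A)\<^sup>2)"

definition pure_states :: "(complex ^ 'n) set" where
  "pure_states = {w. norm w = 1}"

definition eigenvectors :: "complex ^ 'n ^ 'n \<Rightarrow> (complex ^ 'n) set" where
  "eigenvectors A = {w. norm w = 1 \<and> (\<exists>c. A *v w = c *s w)}"

definition Gamma2 ::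
    "nat \<Rightarrow> (nat \<Rightarrow> real) \<Rightarrow> (nat \<Rightarrow> complex ^ 'w ^ 'w) \<Rightarrow> complex ^ 'w \<Rightarrow> real" where
  "Gamma2 N s D w = (\<Sum>i=1..N. (s i)\<^sup>2 * Var w (D i))"

definition minimizes_over :: "('a \<Rightarrow> real) \<Rightarrow> 'a set \<Rightarrow> 'a \<Rightarrow> bool" where
  "minimizes_over f S x \<longleftrightarrow> x \<in> S \<and> (\<forall>y\<in>S. f x \<le> f y)"

definition locally_minimizes_over ::
    "('a::topological_space \<Rightarrow> real) \<Rightarrow> 'a set \<Rightarrow> 'a \<Rightarrow> bool" where
  "locally_minimizes_over f S x \<longleftrightarrow> x \<in> S \<and> (\<forall>\<^sub>F y in at x within S. f x \<le> f y)"

end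

theory Submission
  imports Defs
begin

text \<open>A traceless Hermitian \<open>2 \<times> 2\<close> matrix of unit Hilbert-Schmidt norm squares to half the identity,
  so \<open>Var w (D i) = 1/2 - e\<^sub>i\<^sup>2\<close>, where \<open>e\<^sub>i\<close> is the expectation of \<open>D i\<close>. In Bloch coordinates \<open>e\<^sub>i\<close>
  is the inner product of the Bloch vector of \<open>w\<close> with one of three orthogonal vectors of squared
  norm \<open>1/2\<close>, so \<open>e\<^sub>1\<^sup>2 + e\<^sub>2\<^sup>2 + e\<^sub>3\<^sup>2 \<le> 1/2\<close> by Bessel's inequality. Since \<open>s\<^sub>1\<close> is the largest coefficient,
  \<open>Gamma2\<close> is at least \<open>(s\<^sub>2\<^sup>2 + s\<^sub>3\<^sup>2)/2\<close>. At an eigenvector of \<open>D 1\<close> the variance of \<open>D 1\<close> vanishes, which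
  forces \<open>e\<^sub>1\<^sup>2 = 1/2\<close> and \<open>e\<^sub>2 = e\<^sub>3 = 0\<close>, so the bound is attained: the minimum is even global over the
  pure states.\<close>

text \<open>The real part is the \<open>z\<close> coordinate and the complex part is
  \<open>x - i y\<close>. Bloch space is encoded as \<open>real \<times> complex\<close> so that its
  inner product is the one already present on the product type.\<close>

definition bloch :: "complex ^ 2 \<Rightarrow> real \<times> complex" where
  "bloch w = ((cmod (w $ 1))\<^sup>2 - (cmod (w $ 2))\<^sup>2, 2 * (w $ 1 * cnj (w $ 2)))"

text \<open>For a traceless Hermitian matrix, these are its coefficients in the Pauli matrices,
  packed in the same \<open>(z, x - i y)\<close> convention as \<open>bloch\<close>.\<close>

definition pauli_vec :: "complex ^ 2 ^ 2 \<Rightarrow> real \<times> complex" where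
  "pauli_vec A = (Re (A $ 1 $ 1), A $ 1 $ 2)"

lemma norm_bloch:
  assumes "norm w = 1"
  shows "bloch w \<bullet> bloch w = 1"
proof -
  have 1: "(cmod (w $ 1))\<^sup>2 + (cmod (w $ 2))\<^sup>2 = 1"
    using assms by (simp add: norm_vec_def L2_set_def UNIV_2)
  have "bloch w \<bullet> bloch w = ((cmod (w $ 1))\<^sup>2 + (cmod (w $ 2))\<^sup>2)\<^sup>2"
    unfolding bloch_def inner_Pair unfolding dot_square_norm
    by (simp add: norm_mult power_mult_distrib) (simp add: power2_eq_square algebra_simps)
  then show ?thesis using 1 by simp
qed

lemma traceless_hermitian_entries:
  fixes A :: "complex ^ 2 ^ 2"
  assumes "hermitian A" "trace A = 0"
  shows "A $ 1 $ 1 = of_real (Re (A $ 1 $ 1))" "A $ 2 $ 2 = - of_real (Re (A $ 1 $ 1))"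
    "A $ 2 $ 1 = cnj (A $ 1 $ 2)"
proof -
  have "A $ 1 $ 1 = cnj (A $ 1 $ 1)" "A $ 2 $ 1 = cnj (A $ 1 $ 2)"
    using assms(1) unfolding hermitian_def by blast+
  moreover have "A $ 2 $ 2 = - A $ 1 $ 1"
    using assms(2) by (simp add: trace_def sum_2 add_eq_0_iff)
  ultimately show "A $ 1 $ 1 = of_real (Re (A $ 1 $ 1))" "A $ 2 $ 2 = - of_real (Re (A $ 1 $ 1))"
    "A $ 2 $ 1 = cnj (A $ 1 $ 2)"
    by (auto simp: complex_eq_iff)
qed

lemma trace_mult_pauli:
  fixes A B :: "complex ^ 2 ^ 2"
  assumes "hermitian A" "trace A = 0" "hermitian B" "trace B = 0"
  shows "trace (A ** B) = of_real (2 * (pauli_vec A \<bullet> pauli_vec B))"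
proof -
  note a = traceless_hermitian_entries[OF assms(1,2)] and b = traceless_hermitian_entries[OF assms(3,4)]
  show ?thesis
    using a b
    by (simp add: trace_def matrix_matrix_mult_def sum_2 pauli_vec_def inner_complex_def
        complex_eq_iff algebra_simps)
qed

lemma expect_pauli:
  fixes A :: "complex ^ 2 ^ 2"
  assumes "hermitian A" "trace A = 0"
  shows "expect w A = of_real (bloch w \<bullet> pauli_vec A)"
proof -
  note a = traceless_hermitian_entries[OF assms]
  show ?thesis
    using a unfolding bloch_def cmod_power2
    by (simp add: expect_def matrix_vector_mult_def sum_2 pauli_vec_def inner_complex_def
        complex_eq_iff power2_eq_square algebra_simps)
qed

lemma Var_pauli:
  fixes A :: "complex ^ 2 ^ 2"
  assumes "hermitian A" "trace A = 0" "trace (A ** A) = 1" "norm w = 1"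
  shows "Var w A = 1 / 2 - (bloch w \<bullet> pauli_vec A)\<^sup>2"
proof -
  note a = traceless_hermitian_entries[OF assms(1,2)]
  have p: "pauli_vec A \<bullet> pauli_vec A = 1 / 2"
    using trace_mult_pauli[OF assms(1,2,1,2)] assms(3)
    by (metis of_real_1 of_real_eq_iff field_sum_of_halves mult_2 mult_left_cancel zero_neq_numeral)
  have sq: "(Re (A $ 1 $ 1))\<^sup>2 + (Re (A $ 1 $ 2))\<^sup>2 + (Im (A $ 1 $ 2))\<^sup>2 = 1 / 2"
    using p by (simp add: pauli_vec_def inner_complex_def power2_eq_square)
  \<comment> \<open>The off-diagonal entries cancel because the two diagonal entries of
    \<open>A\<close> are opposite; both diagonal entries of the square are the left side of
    \<open>sq\<close>.\<close>
  have "A ** A = (1 / 2) *\<^sub>R mat 1"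
    using a sq
    by (simp add: vec_eq_iff forall_2 matrix_matrix_mult_def sum_2 mat_def complex_eq_iff
        power2_eq_square algebra_simps)
  moreover have "(norm w)\<^sup>2 = (Re (w $ 1))\<^sup>2 + (Im (w $ 1))\<^sup>2 + (Re (w $ 2))\<^sup>2 + (Im (w $ 2))\<^sup>2"
    by (simp add: norm_vec_def L2_set_def sum_2 cmod_power2)
  ultimately have "Re (expect w (A ** A)) = (norm w)\<^sup>2 / 2"
    by (simp add: expect_def sum_2 matrix_vector_mult_def mat_def complex_eq_iff)
       (simp add: power2_eq_square field_simps)
  then show ?thesis
    using assms(4) expect_pauli[OF assms(1,2)] by (simp add: Var_def power2_eq_square)
qed

text \<open>On a unit eigenvector with eigenvalue \<open>c\<close>, the expectations of
  \<open>A\<close> and \<open>A ** A\<close> are \<open>c\<close> and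
  \<open>c\<^sup>2\<close>.\<close>

lemma Var_eigenvector:
  assumes "w \<in> eigenvectors A"
  shows "Var w A = 0"
proof -
  obtain c where c: "A *v w = c *s w" and n: "norm w = 1"
    using assms by (auto simp: eigenvectors_def)
  have "(\<Sum>i\<in>UNIV. cnj (w $ i) * w $ i) = of_real ((norm w)\<^sup>2)"
    by (simp add: norm_vec_def L2_set_def sum_nonneg mult.commute complex_norm_square[symmetric])
  then have 1: "(\<Sum>i\<in>UNIV. cnj (w $ i) * w $ i) = 1"
    using n by simp
  have scale: "(\<Sum>i\<in>UNIV. cnj (w $ i) * (d *s w) $ i) = d" for d
    using 1 by (simp add: mult.left_commute[of _ d] sum_distrib_left[symmetric])
  have "(A ** A) *v w = c\<^sup>2 *s w"
    by (simp add: matrix_vector_mul_assoc[symmetric] c vector_scalar_commute power2_eq_square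
        vector_smult_assoc)
  then show ?thesis
    by (simp add: Var_def expect_def c scale del: vector_smult_component)
qed

lemma bessel_inequality:
  fixes u :: "'i \<Rightarrow> 'a::real_inner"
  assumes "finite I" "c > 0" "\<And>i j. i \<in> I \<Longrightarrow> j \<in> I \<Longrightarrow> u i \<bullet> u j = (if i = j then c else 0)"
  shows "(\<Sum>i\<in>I. (v \<bullet> u i)\<^sup>2) \<le> c * (v \<bullet> v)"
proof -
  \<comment> \<open>This is \<open>c\<close> times the orthogonal projection of \<open>v\<close>
    onto the span of the \<open>u i\<close>, so \<open>c *\<^sub>R v - p\<close> is orthogonal to
    that span; expanding its squared norm gives the claim.\<close>
  define p where "p = (\<Sum>i\<in>I. (v \<bullet> u i) *\<^sub>R u i)"
  let ?S = "\<Sum>i\<in>I. (v \<bullet> u i)\<^sup>2"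
  have vp: "v \<bullet> p = ?S"
    by (simp add: p_def inner_sum_right power2_eq_square)
  have "u i \<bullet> p = c * (v \<bullet> u i)" if "i \<in> I" for i
  proof -
    have "u i \<bullet> p = (\<Sum>j\<in>I. if i = j then (v \<bullet> u j) * c else 0)"
      unfolding p_def inner_sum_right using assms(3) that by (intro sum.cong) auto
    then show ?thesis using assms(1) that by simp
  qed
  then have "(\<Sum>i\<in>I. (v \<bullet> u i) * (u i \<bullet> p)) = c * ?S"
    by (simp add: sum_distrib_left power2_eq_square mult.left_commute)
  then have pp: "p \<bullet> p = c * ?S"
    by (subst (1) p_def) (simp add: inner_sum_left)
  have "0 \<le> (c *\<^sub>R v - p) \<bullet> (c *\<^sub>R v - p)"
    by simp
  also have "\<dots> = c * (c * (v \<bullet> v) - ?S)"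
    by (simp add: inner_diff_left inner_diff_right inner_commute[of p v] vp pp algebra_simps)
  finally show ?thesis
    using assms(2) by (simp add: zero_le_mult_iff)
qed

theorem proposition4:
  fixes \<sigma>l :: "nat \<Rightarrow> complex ^ 'l ^ 'l"
    and \<sigma>w :: "nat \<Rightarrow> complex ^ 2 ^ 2"
    and H :: "complex ^ ('l \<times> 2) ^ ('l \<times> 2)"
    and s :: "nat \<Rightarrow> real"
    and C :: "nat \<Rightarrow> complex ^ 'l ^ 'l"
    and D :: "nat \<Rightarrow> complex ^ 2 ^ 2"
    and w :: "complex ^ 2"
  defines "N \<equiv> (min CARD('l) CARD(2))\<^sup>2"
  assumes "CARD('l) \<ge> 2"
    and "hermitian_onb \<sigma>l" and "hermitian_onb \<sigma>w"
    and "pure_interaction \<sigma>l \<sigma>w H"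
    and "operator_schmidt H s C D"
    and "\<And>i. 1 < i \<Longrightarrow> i \<le> N \<Longrightarrow> s i < s 1"
    and "w \<in> eigenvectors (D 1)"
  shows "minimizes_over (Gamma2 N s D) (\<Union>i\<in>{1..3}. eigenvectors (D i)) w
       \<and> locally_minimizes_over (Gamma2 N s D) pure_states w"
proof -
  have N: "N = 4"
    using assms(2) by (simp add: N_def)
  have I4: "{1..4::nat} = {1, 2, 3, 4}" by auto
  have I3: "{1..3::nat} = {1, 2, 3}" by auto
  have os: "antimono_on {1..4} s" "s 4 = 0" "\<And>i. i \<in> {1..4} \<Longrightarrow> hermitian (D i)"
    "\<And>i j. i \<in> {1..4} \<Longrightarrow> j \<in> {1..4} \<Longrightarrow> trace (D i ** D j) = (if i = j then 1 else 0)"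
    "\<And>i. i \<in> {1..<4} \<Longrightarrow> trace (D i) = 0"
    using \<open>operator_schmidt H s C D\<close> N unfolding operator_schmidt_def Let_def N_def by auto
  have s: "(s i)\<^sup>2 \<le> (s 1)\<^sup>2" if "i \<in> {1..3}" for i
  proof -
    \<comment> \<open>The lower bound \<open>s 4 = 0\<close> supplies the nonnegativity that lets
      the order survive squaring.\<close>
    have "s 4 \<le> s i" "s i \<le> s 1"
      using os(1) that by (auto simp: monotone_on_def)
    then show ?thesis using os(2) by (intro power_mono) auto
  qed
  define e where "e y i = bloch y \<bullet> pauli_vec (D i)" for y i
  have V: "Var y (D i) = 1 / 2 - (e y i)\<^sup>2" if "norm y = 1" "i \<in> {1..3}" for y i
    unfolding e_def using that by (intro Var_pauli) (auto simp: os)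
  \<comment> \<open>The fourth term, whose operator is not traceless, drops out because
    \<open>s 4 = 0\<close>.\<close>
  have G: "Gamma2 N s D y = (\<Sum>i=1..3. (s i)\<^sup>2 * (1 / 2 - (e y i)\<^sup>2))" if "norm y = 1" for y
    unfolding Gamma2_def N I4 I3 using that by (simp add: os(2) V)
  have orth: "pauli_vec (D i) \<bullet> pauli_vec (D j) = (if i = j then 1 / 2 else 0)"
    if "i \<in> {1..3}" "j \<in> {1..3}" for i j
  proof -
    have "complex_of_real (2 * (pauli_vec (D i) \<bullet> pauli_vec (D j))) = of_real (if i = j then 1 else 0)"
      using that os(4)[of i j] by (subst trace_mult_pauli[symmetric]) (auto simp: os)
    then have "2 * (pauli_vec (D i) \<bullet> pauli_vec (D j)) = (if i = j then 1 else 0)"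
      by (simp only: of_real_eq_iff)
    then show ?thesis by (auto split: if_splits)
  qed
  have bessel: "(\<Sum>i=1..3. (e y i)\<^sup>2) \<le> 1 / 2" if "norm y = 1" for y
    using bessel_inequality[of "{1..3}" "1/2" "\<lambda>i. pauli_vec (D i)" "bloch y", OF _ _ orth]
      norm_bloch[OF that] by (simp add: e_def)
  have nw: "norm w = 1"
    using assms by (simp add: eigenvectors_def)
  have e1: "(e w 1)\<^sup>2 = 1 / 2"
    using V[OF nw, of 1] Var_eigenvector[OF \<open>w \<in> eigenvectors (D 1)\<close>] by simp
  have "(e w 2)\<^sup>2 + (e w 3)\<^sup>2 \<le> 0"
    using bessel[OF nw, unfolded I3] e1 by simp
  then have e23: "e w 2 = 0" "e w 3 = 0"
    by (simp_all add: sum_power2_le_zero_iff)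
  have Gw: "Gamma2 N s D w = (\<Sum>i=1..3. (s i)\<^sup>2 / 2) - (s 1)\<^sup>2 / 2"
    unfolding G[OF nw] I3 using e1 by (simp add: e23)
  have min: "Gamma2 N s D w \<le> Gamma2 N s D y" if "norm y = 1" for y
  proof -
    \<comment> \<open>Raising every weight to the largest one leaves a multiple of the Bessel sum.
      This bounds the only part of \<open>Gamma2\<close> that depends on the state.\<close>
    have "(\<Sum>i=1..3. (s i)\<^sup>2 * (e y i)\<^sup>2) \<le> (\<Sum>i=1..3. (s 1)\<^sup>2 * (e y i)\<^sup>2)"
      by (intro sum_mono mult_right_mono s) auto
    also have "\<dots> \<le> (s 1)\<^sup>2 * (1 / 2)"
      unfolding sum_distrib_left[symmetric] by (intro mult_left_mono bessel that) auto
    finally show ?thesis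
      by (simp add: Gw G[OF that] right_diff_distrib sum_subtractf)
  qed
  show ?thesis
    unfolding minimizes_over_def locally_minimizes_over_def
  proof (intro conjI ballI)
    show "w \<in> (\<Union>i\<in>{1..3}. eigenvectors (D i))"
      using \<open>w \<in> eigenvectors (D 1)\<close> by force
    show "Gamma2 N s D w \<le> Gamma2 N s D y" if "y \<in> (\<Union>i\<in>{1..3}. eigenvectors (D i))" for y
      using that by (intro min) (auto simp: eigenvectors_def)
    show "w \<in> pure_states"
      by (simp add: pure_states_def nw)
    \<comment> \<open>The inequality holds at every pure state, so no particular neighbourhood of
      \<open>w\<close> has to be chosen.\<close>
    show "\<forall>\<^sub>F y in at w within pure_states. Gamma2 N s D w \<le> Gamma2 N s D y"
      by (auto simp: eventually_at_filter pure_states_def intro!: always_eventually min)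
  qed
qed

end
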